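(* Let $\mu_r:\mathcal Q\to[0,1]$ be an interval capacity. Then the robust Choquet integral $Ch_r(\cdot,\mu_r):\mathcal I^n\to\mathbb R$ satisfies: (P1) Idempotency: for every $k\in\mathbb R$ and $\mathbf k=(k,k,\dots,k)$, $Ch_r(\mathbf k,\mu_r)=k$. (P2) Positive homogeneity: for all $a>0$ and $\mathbf x\in\mathcal I^n$, $Ch_r(a\cdot\mathbf x,\mu_r)=a\cdot Ch_r(\mathbf x,\mu_r)$. (P3) Monotonicity: for all $\mathbf x,\mathbf y\in\mathcal I^n$ with $\mathbf x\le\mathbf y$, $Ch_r(\mathbf x,\mu_r)\le Ch_r(\mathbf y,\mu_r)$. (P4) Comonotone additivity: for all comonotone $\mathbf x,\mathbf y\in\mathcal I^n$, $Ch_r(\mathbf x+\mathbf y,\mu_r)=Ch_r(\mathbf x,\mu_r)+Ch_r(\mathbf y,\mu_r)$.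
   Context: Let $n\ge 1$ and $N=\{1,\dots,n\}$. Let $\mathcal I=\{[a,b] : a,b\in\mathbb R,\ a\le b\}$; elements of $\mathcal I^n$ are written $\mathbf x=([\underline x_1,\overline x_1],\dots,[\underline x_n,\overline x_n])$. A real $x$ is identified with $[x,x]$. For $a>0$, $a\cdot[x_1,x_2]=[ax_1,ax_2]$; $[x_1,x_2]+[y_1,y_2]=[x_1+y_1,x_2+y_2]$; both are extended componentwise to $\mathcal I^n$. Order: $[\alpha,\beta]\le[\alpha_1,\beta_1]$ iff $\alpha\le\alpha_1$ and $\beta\le\beta_1$, extended componentwise to $\mathcal I^n$. Two vectors $u,v\in\mathbb R^{m}$ are comonotone if $(u_i-u_j)(v_i-v_j)\ge 0$ for all $i,j$. Two elements $\mathbf x,\mathbf y\in\mathcal I^n$ are comonotone if the vectors $(\underline x_1,\dots,\underline x_n,\overline x_1,\dots,\overline x_n)$ and $(\underline y_1,\dots,\underline y_n,\overline y_1,\dots,\overline y_n)$ of $\mathbb R^{2n}$ are comonotone. Let $\mathcal Q=\{(A,B): A\subseteq B\subseteq N\}$, with $(A,B)\subseteq(C,D)$ meaning $A\subseteq C$ and $B\subseteq D$. An interval capacity is a function $\mu_r:\mathcal Q\to[0,1]$ with $\mu_r(\emptyset,\emptyset)=0$, $\mu_r(N,N)=1$ and $\mu_r(A,B)\le\mu_r(C,D)$ whenever $(A,B)\subseteq(C,D)$. The robust Choquet integral of $\mathbf x\in\mathcal I^n$ with respect to $\mu_r$ is $$Ch_r(\mathbf x,\mu_r)=\int_{\min_i\underline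 x_i}^{\max_i\overline x_i}\mu_r\big(\{i\in N:\underline x_i\ge t\},\{i\in N:\overline x_i\ge t\}\big)\,dt+\min_i\underline x_i .$$ *)

theory Defs
  imports "HOL-Analysis.Analysis" "HOL-Library.Interval"
begin

text \<open>
  The index set \<open>N = {1,...,n}\<close>, \<open>n \<ge> 1\<close>, is the finite (and automatically nonempty) type
  \<open>'n\<close>, so that \<open>N\<close> is \<open>UNIV :: 'n set\<close> and an \<open>n\<close>-tuple of closed real intervals is an element
  of \<open>real interval ^ 'n\<close>. Interval addition is the one of \<open>HOL-Library.Interval\<close>, lifted
  componentwise by the vector type.
\<close>

definition interval_scale :: "real \<Rightarrow> real interval \<Rightarrow> real interval" where
  \<comment> \<open>only meaningful for \<open>a \<ge> 0\<close>; otherwise the endpoints may be in the wrong order\<close>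
  "interval_scale a I = Interval (a * lower I, a * upper I)"

definition ivec_scale :: "real \<Rightarrow> real interval ^ 'n \<Rightarrow> real interval ^ 'n" where
  "ivec_scale a x = (\<chi> i. interval_scale a (x $ i))"

text \<open>
  The instance \<open>\<le>\<close> on the library's interval type is set inclusion, hence the endpointwise
  order gets its own name.
\<close>

definition interval_le :: "real interval \<Rightarrow> real interval \<Rightarrow> bool" where
  "interval_le I J \<longleftrightarrow> lower I \<le> lower J \<and> upper I \<le> upper J"

definition ivec_le :: "real interval ^ 'n \<Rightarrow> real interval ^ 'n \<Rightarrow> bool" where
  "ivec_le x y \<longleftrightarrow> (\<forall>i. interval_le (x $ i) (y $ i))"

definition comonotone :: "real ^ 'm \<Rightarrow> real ^ 'm \<Rightarrow> bool" where
  "comonotone u v \<longleftrightarrow> (\<forall>i j. (u $ i - u $ j) * (v $ i - v $ j) \<ge> 0)"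

text \<open>All lower endpoints followed by all upper endpoints, as a vector in \<open>2n\<close>-space.\<close>

definition endpoints :: "real interval ^ 'n \<Rightarrow> real ^ ('n + 'n)" where
  "endpoints x = (\<chi> k. case k of Inl i \<Rightarrow> lower (x $ i) | Inr i \<Rightarrow> upper (x $ i))"

definition ivec_comonotone :: "real interval ^ 'n \<Rightarrow> real interval ^ 'n \<Rightarrow> bool" where
  "ivec_comonotone x y \<longleftrightarrow> comonotone (endpoints x) (endpoints y)"

definition nested_pairs :: "('n set \<times> 'n set) set" where
  "nested_pairs = {(A, B). A \<subseteq> B}"

text \<open>
  Capacities are total functions of which only the values on \<open>nested_pairs\<close> matter.
\<close>

definition interval_capacity :: "('n set \<times> 'n set \<Rightarrow> real) \<Rightarrow> bool" where
  "interval_capacity \<mu> \<longleftrightarrow>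
     \<mu> \<in> nested_pairs \<rightarrow> {0..1} \<and>
     \<mu> ({}, {}) = 0 \<and>
     \<mu> (UNIV, UNIV) = 1 \<and>
     (\<forall>A B C D. (A, B) \<in> nested_pairs \<longrightarrow> (C, D) \<in> nested_pairs \<longrightarrow>
        A \<subseteq> C \<longrightarrow> B \<subseteq> D \<longrightarrow> \<mu> (A, B) \<le> \<mu> (C, D))"

definition robust_Choquet ::
  "real interval ^ 'n \<Rightarrow> ('n::finite set \<times> 'n set \<Rightarrow> real) \<Rightarrow> real" where
  "robust_Choquet x \<mu> =
     integral {(MIN i. lower (x $ i)) .. (MAX i. upper (x $ i))}
       (\<lambda>t. \<mu> ({i. lower (x $ i) \<ge> t}, {i. upper (x $ i) \<ge> t}))
     + (MIN i. lower (x $ i))"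

end

theory Submission
  imports Defs
begin

text \<open>
  Listing all \<open>2n\<close> endpoints in one vector and reading a pair \<open>(A, B)\<close> as the subset
  \<open>A <+> B\<close> of the disjoint sum turns the robust Choquet integral into an ordinary Choquet
  integral over a set of \<open>2n\<close> elements (\<open>robust_Choquet_eq_Choquet\<close>).  Homogeneity, monotonicity
  and comonotone additivity are then properties of the ordinary integral; idempotency is immediate,
  because for a constant vector the integral runs over a single point.

  Along an enumeration \<open>\<sigma>\<close> of the indices that makes \<open>f\<close> increasing, the level sets of \<open>f\<close>
  are the tails of \<open>\<sigma>\<close>, and the integrand is a step function.  Hence the Choquet integral of \<open>f\<close>
  is the finite sum \<open>Choquet_eq_sum\<close>, which is \<^emph>\<open>linear\<close> in \<open>f\<close> as long as \<open>\<sigma>\<close> is kept fixed.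
  Multiplication by a positive scalar preserves the enumeration, which gives homogeneity.  If
  \<open>f\<close> and \<open>g\<close> are comonotone, then an enumeration that sorts \<open>f + g\<close> sorts \<open>f\<close> and \<open>g\<close> as well
  (\<open>comonotone_le_if_sum_le\<close>), which gives additivity.

  For monotonicity the two integrals are first extended to a common interval, where the integrands
  can be compared pointwise: below the minimum the integrand is \<open>1\<close> and above the maximum it is
  \<open>0\<close>, so moving the limits of integration outwards does not change the value
  (\<open>Choquet_eq_wider\<close>).
\<close>

section \<open>The Choquet integral on a finite set\<close>

definition Choquet :: "('k::finite set \<Rightarrow> real) \<Rightarrow> ('k \<Rightarrow> real) \<Rightarrow> real" where
  "Choquet \<nu> f = integral {Min (range f)..Max (range f)} (\<lambda>t. \<nu> {k. t \<le> f k}) + Min (range f)"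

definition sorts :: "(nat \<Rightarrow> 'k) \<Rightarrow> nat \<Rightarrow> ('k \<Rightarrow> real) \<Rightarrow> bool" where
  "sorts \<sigma> n f \<longleftrightarrow>
     bij_betw \<sigma> {..n} UNIV \<and> (\<forall>i j. i \<le> j \<longrightarrow> j \<le> n \<longrightarrow> f (\<sigma> i) \<le> f (\<sigma> j))"

lemma sortsD:
  assumes "sorts \<sigma> n f"
  shows "i \<le> j \<Longrightarrow> j \<le> n \<Longrightarrow> f (\<sigma> i) \<le> f (\<sigma> j)"
    and "\<exists>i\<le>n. k = \<sigma> i"
proof -
  show "i \<le> j \<Longrightarrow> j \<le> n \<Longrightarrow> f (\<sigma> i) \<le> f (\<sigma> j)"
    using assms by (simp add: sorts_def)
  have "k \<in> \<sigma> ` {..n}"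
    using assms by (simp add: sorts_def bij_betw_def)
  then show "\<exists>i\<le>n. k = \<sigma> i" by auto
qed

text \<open>
  Between two consecutive values \<open>f (\<sigma> j)\<close> and \<open>f (\<sigma> (Suc j))\<close> the level set is the tail
  \<open>\<sigma> ` {Suc j..n}\<close>, so each summand is the area of one rectangle under a step function.  Ties
  contribute rectangles of width zero, so that the formula holds for every sorting enumeration.
\<close>

lemma has_integral_level_sets:
  fixes f :: "'k::finite \<Rightarrow> real" and \<nu> :: "'k set \<Rightarrow> real"
  assumes sorts: "sorts \<sigma> n f"
    and "p \<le> n"
  shows "((\<lambda>t. \<nu> {k. t \<le> f k}) has_integral
           (\<Sum>j<p. (f (\<sigma> (Suc j)) - f (\<sigma> j)) * \<nu> (\<sigma> ` {Suc j..n}))) {f (\<sigma> 0)..f (\<sigma> p)}"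
  using \<open>p \<le> n\<close>
proof (induction p)
  case 0
  then show ?case by (simp add: has_integral_refl)
next
  case (Suc p)
  have level: "{k. t \<le> f k} = \<sigma> ` {Suc p..n}" if t: "f (\<sigma> p) < t" "t \<le> f (\<sigma> (Suc p))" for t
  proof (intro set_eqI iffI)
    fix k assume k: "k \<in> {k. t \<le> f k}"
    obtain i where i: "i \<le> n" "k = \<sigma> i"
      using sortsD(2)[OF sorts] by blast
    have "\<not> i \<le> p"
      using sortsD(1)[OF sorts, of i p] i k t Suc.prems by auto
    with i show "k \<in> \<sigma> ` {Suc p..n}" by auto
  next
    fix k assume "k \<in> \<sigma> ` {Suc p..n}"
    then obtain i where "Suc p \<le> i" "i \<le> n" "k = \<sigma> i" by auto
    then show "k \<in> {k. t \<le> f k}"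
      using sortsD(1)[OF sorts, of "Suc p" i] t by auto
  qed
  have le: "f (\<sigma> p) \<le> f (\<sigma> (Suc p))"
    using sortsD(1)[OF sorts, of p "Suc p"] Suc.prems by simp
  have "((\<lambda>t. \<nu> (\<sigma> ` {Suc p..n})) has_integral
          (f (\<sigma> (Suc p)) - f (\<sigma> p)) * \<nu> (\<sigma> ` {Suc p..n})) {f (\<sigma> p)..f (\<sigma> (Suc p))}"
    using has_integral_const_real[of "\<nu> (\<sigma> ` {Suc p..n})" "f (\<sigma> p)" "f (\<sigma> (Suc p))"] le
    by simp
  \<comment> \<open>The level set at the left endpoint itself may be larger than the tail.\<close>
  then have step: "((\<lambda>t. \<nu> {k. t \<le> f k}) has_integral
          (f (\<sigma> (Suc p)) - f (\<sigma> p)) * \<nu> (\<sigma> ` {Suc p..n})) {f (\<sigma> p)..f (\<sigma> (Suc p))}"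
    by (rule has_integral_spike[OF negligible_sing[of "f (\<sigma> p)"], rotated]) (auto simp: level)
  have "f (\<sigma> 0) \<le> f (\<sigma> p)"
    using sortsD(1)[OF sorts, of 0 p] Suc.prems by simp
  from has_integral_combine[OF this le Suc.IH step] Suc.prems show ?case
    by simp
qed

lemma Min_Max_range_sorted:
  fixes f :: "'k::finite \<Rightarrow> real"
  assumes sorts: "sorts \<sigma> n f"
  shows "Min (range f) = f (\<sigma> 0)" and "Max (range f) = f (\<sigma> n)"
proof -
  have "f (\<sigma> 0) \<le> f k \<and> f k \<le> f (\<sigma> n)" for k
  proof -
    obtain i where "i \<le> n" "k = \<sigma> i"
      using sortsD(2)[OF sorts] by blast
    then show ?thesis using sortsD(1)[OF sorts] by simp
  qed
  then show "Min (range f) = f (\<sigma> 0)" "Max (range f) = f (\<sigma> n)"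
    by (auto intro!: Min_eqI Max_eqI)
qed

lemma Choquet_eq_sum:
  fixes f :: "'k::finite \<Rightarrow> real"
  assumes "sorts \<sigma> n f"
  shows "Choquet \<nu> f =
           (\<Sum>j<n. (f (\<sigma> (Suc j)) - f (\<sigma> j)) * \<nu> (\<sigma> ` {Suc j..n})) + f (\<sigma> 0)"
  unfolding Choquet_def Min_Max_range_sorted[OF assms]
  using has_integral_level_sets[OF assms order_refl, of \<nu>] by (simp add: integral_unique)

lemma sorting_enumeration:
  fixes f :: "'k::finite \<Rightarrow> real"
  obtains \<sigma> n where "sorts \<sigma> n f"
proof -
  obtain xs :: "'k list" where xs: "set xs = UNIV" "distinct xs"
    using finite_distinct_list[OF finite_class.finite_UNIV] by blast
  define ys where "ys = sort_key f xs"
  have ys: "set ys = UNIV" "distinct ys" "sorted (map f ys)"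
    using xs by (simp_all add: ys_def)
  then have "length ys > 0" by auto
  then have len: "{..length ys - 1} = {..<length ys}" by (cases "length ys") auto
  show ?thesis
  proof (rule that[of "(!) ys" "length ys - 1"], unfold sorts_def, intro conjI allI impI)
    show "bij_betw ((!) ys) {..length ys - 1} UNIV"
      using ys len by (intro bij_betw_nth) auto
    show "f (ys ! i) \<le> f (ys ! j)" if "i \<le> j" "j \<le> length ys - 1" for i j
      using sorted_nth_mono[OF ys(3), of i j] that \<open>length ys > 0\<close>
      by (simp add: order_le_less_trans)
  qed
qed

section \<open>Homogeneity, additivity and monotonicity\<close>

lemma Choquet_scale:
  assumes "a > 0"
  shows "Choquet \<nu> (\<lambda>k. a * f k) = a * Choquet \<nu> f"
proof -
  obtain \<sigma> n where sorts: "sorts \<sigma> n f"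
    by (rule sorting_enumeration)
  then have "sorts \<sigma> n (\<lambda>k. a * f k)"
    using assms by (simp add: sorts_def)
  from Choquet_eq_sum[OF this] show ?thesis
    unfolding Choquet_eq_sum[OF sorts]
    by (simp add: sum_distrib_left algebra_simps)
qed

text \<open>
  If \<open>u > u'\<close>, comonotonicity forces \<open>v \<ge> v'\<close>, and the sums would be ordered the other way.
\<close>

lemma comonotone_le_if_sum_le:
  fixes u v u' v' :: real
  assumes "(u - u') * (v - v') \<ge> 0" and "u + v \<le> u' + v'"
  shows "u \<le> u'" and "v \<le> v'"
  using assms by (auto simp: zero_le_mult_iff)

lemma Choquet_comonotone_add:
  assumes com: "\<And>i j. (f i - f j) * (g i - g j) \<ge> 0"
  shows "Choquet \<nu> (\<lambda>k. f k + g k) = Choquet \<nu> f + Choquet \<nu> g"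
proof -
  obtain \<sigma> n where sum: "sorts \<sigma> n (\<lambda>k. f k + g k)"
    by (rule sorting_enumeration[of "\<lambda>k. f k + g k"])
  then have f: "sorts \<sigma> n f" and g: "sorts \<sigma> n g"
    using comonotone_le_if_sum_le[OF com] unfolding sorts_def by blast+
  show ?thesis
    unfolding Choquet_eq_sum[OF f] Choquet_eq_sum[OF g]
      Choquet_eq_sum[OF sum]
    by (simp add: sum.distrib[symmetric] algebra_simps)
qed

lemma Choquet_eq_wider:
  assumes \<nu>: "\<nu> {} = 0" "\<nu> UNIV = 1"
    and a: "a \<le> Min (range f)" and b: "Max (range f) \<le> b"
  shows "((\<lambda>t. \<nu> {k. t \<le> f k}) has_integral (Choquet \<nu> f - a)) {a..b}"
proof -
  let ?G = "\<lambda>t. \<nu> {k. t \<le> f k}" and ?m = "Min (range f)" and ?M = "Max (range f)"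
  obtain \<sigma> n where sorts: "sorts \<sigma> n f"
    by (rule sorting_enumeration)
  have "?G integrable_on {?m..?M}"
    using has_integral_level_sets[OF sorts order_refl, of \<nu>]
    unfolding Min_Max_range_sorted[OF sorts] by blast
  then have mid: "(?G has_integral (Choquet \<nu> f - ?m)) {?m..?M}"
    by (simp add: Choquet_def integrable_integral)
  have "((\<lambda>t. 1) has_integral (?m - a)) {a..?m}"
    using has_integral_const_real[of "1::real" a ?m] a by simp
  moreover have "{k. t \<le> f k} = UNIV" if "t \<le> ?m" for t
    using that by auto
  ultimately have low: "(?G has_integral (?m - a)) {a..?m}"
    by (subst has_integral_cong[where g = "\<lambda>t. 1"]) (auto simp: \<nu>)
  have none: "{k. t \<le> f k} = {}" if "?M < t" for t
    using that by (auto simp: not_le)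
  \<comment> \<open>At \<open>t = ?M\<close> itself the level set is nonempty, so one point has to be left out.\<close>
  have high: "(?G has_integral 0) {?M..b}"
    by (rule has_integral_spike[OF negligible_sing[of ?M], where f = "\<lambda>t. 0"])
      (simp_all add: none \<nu> order_less_le del: Max_le_iff)
  have "?m \<le> ?M" by (simp add: Min_le_iff)
  have "(?G has_integral (?m - a) + (Choquet \<nu> f - ?m)) {a..?M}"
    using a \<open>?m \<le> ?M\<close> low mid by (rule has_integral_combine)
  from has_integral_combine[OF order_trans[OF a \<open>?m \<le> ?M\<close>] b this high]
  show ?thesis by simp
qed

text \<open>
  Monotonicity of \<open>\<nu>\<close> is required only between the level sets at hand, because the set function
  coming from an interval capacity is monotone only on subsets that encode nested pairs.
\<close>

lemma Choquet_mono:
  assumes \<nu>: "\<nu> {} = 0" "\<nu> UNIV = 1"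
    and mono: "\<And>t. \<nu> {k. t \<le> f k} \<le> \<nu> {k. t \<le> g k}"
  shows "Choquet \<nu> f \<le> Choquet \<nu> g"
proof -
  let ?a = "min (Min (range f)) (Min (range g))"
  let ?b = "max (Max (range f)) (Max (range g))"
  have "Choquet \<nu> f - ?a \<le> Choquet \<nu> g - ?a"
    by (rule has_integral_le[OF Choquet_eq_wider[OF \<nu>, of ?a f ?b]
          Choquet_eq_wider[OF \<nu>, of ?a g ?b]]) (auto simp: mono)
  then show ?thesis by simp
qed

section \<open>The robust Choquet integral as a Choquet integral of the endpoints\<close>

text \<open>
  The inverse of the encoding \<open>(A, B) \<mapsto> A <+> B\<close>, followed by \<open>\<mu>\<close>.  A level set of endpoints always
  encodes a nested pair, because an upper endpoint reaches every level that the lower one reaches.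
\<close>

definition sum_set_function :: "('n set \<times> 'n set \<Rightarrow> real) \<Rightarrow> ('n + 'n) set \<Rightarrow> real" where
  "sum_set_function \<mu> S = \<mu> (Inl -` S, Inr -` S)"

lemma endpoints_simps [simp]:
  "endpoints x $ Inl i = lower (x $ i)" "endpoints x $ Inr i = upper (x $ i)"
  by (simp_all add: endpoints_def)

text \<open>
  As every lower endpoint is at most the upper endpoint of the same interval, the minimum over all
  endpoints is attained at a lower one and the maximum at an upper one, so the limits of
  integration agree.
\<close>

lemma robust_Choquet_eq_Choquet:
  fixes x :: "real interval ^ 'n::finite"
  shows "robust_Choquet x \<mu> = Choquet (sum_set_function \<mu>) (($) (endpoints x))"
proof -
  have "Min (range (($) (endpoints x))) = (MIN i. lower (x $ i))"
  proof (rule Min_eqI)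
    show "(MIN i. lower (x $ i)) \<le> y" if y: "y \<in> range (($) (endpoints x))" for y
    proof -
      obtain k where "y = endpoints x $ k" using y by blast
      then obtain i where "lower (x $ i) \<le> y"
        by (cases k) (auto intro: lower_le_upper)
      moreover have "(MIN i. lower (x $ i)) \<le> lower (x $ i)" by simp
      ultimately show ?thesis by linarith
    qed
    have "(MIN i. lower (x $ i)) \<in> range (\<lambda>i. lower (x $ i))"
      by (rule Min_in) auto
    then show "(MIN i. lower (x $ i)) \<in> range (($) (endpoints x))"
      by (metis (no_types, lifting) endpoints_simps(1) imageE rangeI)
  qed simp
  moreover have "Max (range (($) (endpoints x))) = (MAX i. upper (x $ i))"
  proof (rule Max_eqI)
    show "y \<le> (MAX i. upper (x $ i))" if y: "y \<in> range (($) (endpoints x))" for y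
    proof -
      obtain k where "y = endpoints x $ k" using y by blast
      then obtain i where "y \<le> upper (x $ i)"
        by (cases k) (auto intro: lower_le_upper)
      moreover have "upper (x $ i) \<le> (MAX i. upper (x $ i))" by simp
      ultimately show ?thesis by linarith
    qed
    have "(MAX i. upper (x $ i)) \<in> range (\<lambda>i. upper (x $ i))"
      by (rule Max_in) auto
    then show "(MAX i. upper (x $ i)) \<in> range (($) (endpoints x))"
      by (metis (no_types, lifting) endpoints_simps(2) imageE rangeI)
  qed simp
  ultimately show ?thesis
    by (simp add: robust_Choquet_def Choquet_def sum_set_function_def vimage_def)
qed

lemma endpoints_add:
  "endpoints (x + y) $ k = endpoints x $ k + endpoints y $ k"
  by (cases k) simp_all

lemma endpoints_scale:
  assumes "a > 0"
  shows "endpoints (ivec_scale a x) $ k = a * endpoints x $ k"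
proof -
  have "a * lower I \<le> a * upper I" for I :: "real interval"
    using assms by (simp add: lower_le_upper)
  then show ?thesis
    by (cases k) (simp_all add: ivec_scale_def interval_scale_def
        lower.rep_eq upper.rep_eq Interval_inverse)
qed

lemma sum_set_function_level_mono:
  fixes x y :: "real interval ^ 'n::finite"
  assumes "interval_capacity \<mu>" and "ivec_le x y"
  shows "sum_set_function \<mu> {k. t \<le> endpoints x $ k} \<le> sum_set_function \<mu> {k. t \<le> endpoints y $ k}"
proof -
  have nested: "({i. t \<le> lower (z $ i)}, {i. t \<le> upper (z $ i)}) \<in> nested_pairs"
    for z :: "real interval ^ 'n"
    by (auto simp: nested_pairs_def intro: order_trans lower_le_upper)
  have "{i. t \<le> lower (x $ i)} \<subseteq> {i. t \<le> lower (y $ i)}"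
    "{i. t \<le> upper (x $ i)} \<subseteq> {i. t \<le> upper (y $ i)}"
    using assms(2) by (auto simp: ivec_le_def interval_le_def intro: order_trans)
  with nested[of x] nested[of y] assms(1) show ?thesis
    by (simp add: sum_set_function_def vimage_def interval_capacity_def)
qed

theorem mainTheorem2:
  fixes \<mu> :: "'n::finite set \<times> 'n set \<Rightarrow> real"
  assumes "interval_capacity \<mu>"
  shows "(\<forall>k::real. robust_Choquet (\<chi> i. interval_of k) \<mu> = k) \<and>
         (\<forall>(a::real) (x :: real interval ^ 'n).
            a > 0 \<longrightarrow> robust_Choquet (ivec_scale a x) \<mu> = a * robust_Choquet x \<mu>) \<and>
         (\<forall>(x :: real interval ^ 'n) y.
            ivec_le x y \<longrightarrow> robust_Choquet x \<mu> \<le> robust_Choquet y \<mu>) \<and>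
         (\<forall>(x :: real interval ^ 'n) y.
            ivec_comonotone x y \<longrightarrow>
            robust_Choquet (x + y) \<mu> = robust_Choquet x \<mu> + robust_Choquet y \<mu>)"
proof (intro conjI allI impI)
  fix k :: real
  show "robust_Choquet (\<chi> i. interval_of k) \<mu> = k"
    by (simp add: robust_Choquet_def)
next
  fix a :: real and x :: "real interval ^ 'n"
  assume "a > 0"
  then have "($) (endpoints (ivec_scale a x)) = (\<lambda>k. a * endpoints x $ k)"
    by (simp add: endpoints_scale fun_eq_iff)
  with \<open>a > 0\<close> show "robust_Choquet (ivec_scale a x) \<mu> = a * robust_Choquet x \<mu>"
    by (simp add: robust_Choquet_eq_Choquet Choquet_scale)
next
  fix x y :: "real interval ^ 'n"
  assume "ivec_le x y"
  with assms show "robust_Choquet x \<mu> \<le> robust_Choquet y \<mu>"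
    unfolding robust_Choquet_eq_Choquet
    by (intro Choquet_mono sum_set_function_level_mono)
      (auto simp: sum_set_function_def interval_capacity_def)
next
  fix x y :: "real interval ^ 'n"
  assume "ivec_comonotone x y"
  then have "(endpoints x $ i - endpoints x $ j) * (endpoints y $ i - endpoints y $ j) \<ge> 0" for i j
    by (simp add: ivec_comonotone_def comonotone_def)
  from Choquet_comonotone_add[OF this]
  show "robust_Choquet (x + y) \<mu> = robust_Choquet x \<mu> + robust_Choquet y \<mu>"
    by (simp add: robust_Choquet_eq_Choquet endpoints_add[abs_def])
qed

end
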